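(* If $w\in W$ is $\Phi$-finite, then $\Phi_w$ is the power series expansion of a rational function in $X$ and $Y$ with denominator in $1+Y\mathbb{Z}[X,Y]$.
   Context: Let $T$ be the infinite rooted regular binary tree whose vertices are the finite words over $\{0,1\}$, with root the empty word, each word $t$ being joined by an edge to the words $0t$ and $1t$. Level $n$ of $T$ is the set of words of length $n$. Let $W=\mathrm{Aut}(T)$ be the automorphism group of $T$ (products are compositions, $(uv)(t)=u(v(t))$), with identity element $1$. For $u,v\in W$, let $(u,v)\in W$ be the automorphism fixing the root and given by $t0\mapsto u(t)0$ and $t1\mapsto v(t)1$ for every word $t$. Let $\sigma\in W$ be the involution fixing the root with $t0\mapsto t1$ and $t1\mapsto t0$ for every word $t$. Then $W=(W\times W)\rtimes\langle\sigma\rangle$, so every $w\in W$ can be written uniquely as $(u,v)$ or as $(u,v)\,\sigma$. For $w\in W$, every orbit of $w$ on level $n$ has length $2^m$ for some $0\le m\le n$. The orbit length generating function of $w$ is $\Phi_w=\sum_{n\ge m\ge 0}o_{m,n}(w)X^mY^n\in 1+Y\mathbb{Z}[[X,Y]]$, where $o_{m,n}(w)$ is the number of orbits of $w$ of length $2^m$ on level $n$. The first descendants of $w\in W$ are the elements $u$ and $v$ if $w=(u,v)$, respectively the single element $uv$ if $w=(u,v)\,\sigma$. For $n\ge1$, the first descendants of the $n$-th descendants of $w$ are the $(n+1)$-st descendants of $w$. $\mathrm{Desc}(w)$ is the set of all $n$-th descendants of $w$ for all $n\ge1$. An element $w$ is called $\Phi$-finite if $\mathrm{Desc}(w)$ is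 finite. *)

theory Defs
  imports
    "HOL-Computational_Algebra.Computational_Algebra"
    "HOL-Combinatorics.Orbits"
begin

text \<open>Letters are booleans, with 0 = \<open>False\<close> and 1 = \<open>True\<close>. A child of a word is obtained by
  prepending a letter, so the subtree below the length-one word \<open>[x]\<close> consists of
  the words \<open>t @ [x]\<close>.\<close>

type_synonym word = "bool list"

definition tree_adj :: "word \<Rightarrow> word \<Rightarrow> bool" where
  "tree_adj s t \<longleftrightarrow> (\<exists>x. t = x # s \<or> s = x # t)"

definition level :: "nat \<Rightarrow> word set" where
  "level n = {t. length t = n}"

definition W :: "(word \<Rightarrow> word) set" where
  "W = {w. bij w \<and> w [] = [] \<and> (\<forall>s t. tree_adj (w s) (w t) \<longleftrightarrow> tree_adj s t)}"

definition pair :: "(word \<Rightarrow> word) \<Rightarrow> (word \<Rightarrow> word) \<Rightarrow> word \<Rightarrow> word" where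
  "pair u v s =
     (if s = [] then []
      else if last s then v (butlast s) @ [True] else u (butlast s) @ [False])"

definition sigma :: "word \<Rightarrow> word" where
  "sigma s = (if s = [] then [] else butlast s @ [\<not> last s])"

definition first_descendants :: "(word \<Rightarrow> word) \<Rightarrow> (word \<Rightarrow> word) set" where
  "first_descendants w =
     {x. \<exists>u\<in>W. \<exists>v\<in>W. w = pair u v \<and> (x = u \<or> x = v) \<or> w = pair u v \<circ> sigma \<and> x = u \<circ> v}"

primrec descendants :: "nat \<Rightarrow> (word \<Rightarrow> word) \<Rightarrow> (word \<Rightarrow> word) set" where
  "descendants 0 w = {w}"
| "descendants (Suc n) w = (\<Union>x\<in>descendants n w. first_descendants x)"

definition Desc :: "(word \<Rightarrow> word) \<Rightarrow> (word \<Rightarrow> word) set" where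
  "Desc w = (\<Union>n\<in>{1..}. descendants n w)"

definition Phi_finite :: "(word \<Rightarrow> word) \<Rightarrow> bool" where
  "Phi_finite w \<longleftrightarrow> finite (Desc w)"

text \<open>The library's \<open>orbit w t\<close> collects the positive iterates of \<open>w\<close> at \<open>t\<close>; as \<open>w \<in> W\<close> permutes
  each finite level, this is the orbit of \<open>t\<close> under the cyclic group generated by \<open>w\<close>.\<close>

definition orbit_count :: "nat \<Rightarrow> nat \<Rightarrow> (word \<Rightarrow> word) \<Rightarrow> nat" where
  "orbit_count m n w = card {A \<in> orbit w ` level n. card A = 2 ^ m}"

text \<open>The ring of power series in \<open>X\<close> and \<open>Y\<close> over the integers is rendered as \<open>int fps fps\<close>, and
  that of polynomials as \<open>int poly poly\<close>: the outer variable is \<open>Y\<close>, the inner one \<open>X\<close>.\<close>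

definition Phi :: "(word \<Rightarrow> word) \<Rightarrow> int fps fps" where
  "Phi w = Abs_fps (\<lambda>n. Abs_fps (\<lambda>m. if m \<le> n then int (orbit_count m n w) else 0))"

definition fps2_of_poly2 :: "int poly poly \<Rightarrow> int fps fps" where
  "fps2_of_poly2 P = fps_of_poly (map_poly fps_of_poly P)"

text \<open>A polynomial \<open>Q\<close> in \<open>1 + Y\<int>[X,Y]\<close> is a unit among the power series, so the equation
  \<open>F Q = P\<close> says that \<open>F\<close> is the power series expansion of \<open>P / Q\<close>.\<close>

definition expansion_of_quotient :: "int fps fps \<Rightarrow> int poly poly \<Rightarrow> int poly poly \<Rightarrow> bool" where
  "expansion_of_quotient F P Q \<longleftrightarrow> F * fps2_of_poly2 Q = fps2_of_poly2 P"

end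

theory Submission
  imports Defs
begin

text \<open>An orbit of \<open>pair u v\<close> below the root is an orbit of \<open>u\<close> or of \<open>v\<close> with a letter appended, while
  an orbit of \<open>pair u v \<circ> sigma\<close> meets the subtree at \<open>[False]\<close> in an orbit of \<open>u \<circ> v\<close> of half its
  length. So \<open>\<Phi>\<close> equals \<open>1 + Y (\<Phi> u + \<Phi> v)\<close> in the first case and \<open>1 + X Y \<Phi> (u \<circ> v)\<close> in the
  second. If \<open>w\<close> has finitely many descendants, these equations form a finite linear system
  \<open>F = b + Y A F\<close> over the polynomial ring, and Gaussian elimination divides only by polynomials
  with constant term 1 in \<open>Y\<close>.\<close>

section \<open>Linear systems\<close>

text \<open>Gaussian elimination, by induction on the set of unknowns. Nothing is divided:
  denominators are multiplied out, and they keep the form \<open>1 + y * r\<close> because such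
  elements are closed under products. Below, \<open>h\<close> is the embedding of polynomials in
  power series and \<open>y\<close> is the variable \<open>Y\<close>.\<close>

lemma linear_system_common_denominator:
  fixes h :: "'p::comm_ring_1 \<Rightarrow> 'r::comm_ring_1" and F :: "'i \<Rightarrow> 'r"
  assumes h_add: "\<And>p q. h (p + q) = h p + h q"
    and h_mult: "\<And>p q. h (p * q) = h p * h q" and h_1: "h 1 = 1"
    and "finite S"
    and "\<And>s. s \<in> S \<Longrightarrow> F s = h (b s) + h y * (\<Sum>t\<in>S. h (a s t) * F t)"
  shows "\<exists>r. \<forall>s\<in>S. \<exists>p. h (1 + y * r) * F s = h p"
  using assms(4,5)
proof (induction S arbitrary: a b rule: finite_induct)
  case empty
  then show ?case by simp
next
  case (insert x S)
  have h_0: "h 0 = 0" using h_add[of 0 0] by simp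
  have h_neg: "h (- p) = - h p" for p using h_add[of p "- p"] h_0 by (simp add: minus_unique)
  have h_diff: "h (p - q) = h p - h q" for p q using h_add[of p "- q"] h_neg by simp
  have h_sum: "h (\<Sum>t\<in>A. f t) = (\<Sum>t\<in>A. h (f t))" if "finite A" for A :: "'i set" and f
    using that by induction (simp_all add: h_0 h_add)
  \<comment> \<open>This is the factor of \<open>F x\<close> once its own term is moved to the left
    of its equation.\<close>
  define q where "q = 1 - y * a x x"
  \<comment> \<open>Multiply the equation for \<open>s\<close> by \<open>q\<close> and substitute
    \<open>Fx\<close>. On the left \<open>q * F s\<close> falls short of \<open>F s\<close> by
    \<open>y * a x x * F s\<close>; moving this to the right produces the diagonal term, so the
    smaller system has the original shape.\<close>
  define a' where "a' s t = q * a s t + y * a s x * a x t + (if s = t then a x x else 0)" for s t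
  define b' where "b' s = q * b s + y * a s x * b x" for s
  have Fx: "h q * F x = h (b x) + h y * (\<Sum>t\<in>S. h (a x t) * F t)"
    using insert.prems[of x] insert.hyps
    by (simp add: q_def h_diff h_mult h_1 algebra_simps)
  have "F s = h (b' s) + h y * (\<Sum>t\<in>S. h (a' s t) * F t)" if s: "s \<in> S" for s
  proof -
    have "(\<Sum>t\<in>S. h (a' s t) * F t) = (\<Sum>t\<in>S. h q * (h (a s t) * F t)
        + h y * h (a s x) * (h (a x t) * F t) + (if s = t then h (a x x) * F t else 0))"
      by (rule sum.cong) (auto simp: a'_def h_add h_mult h_0 algebra_simps)
    also have "\<dots> = h q * (\<Sum>t\<in>S. h (a s t) * F t)
        + h y * h (a s x) * (\<Sum>t\<in>S. h (a x t) * F t) + h (a x x) * F s"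
      using s insert.hyps by (simp add: sum.distrib sum_distrib_left)
    finally have A: "(\<Sum>t\<in>S. h (a' s t) * F t) = \<dots>" .
    have "F s = h (b s) + h y * (h (a s x) * F x + (\<Sum>t\<in>S. h (a s t) * F t))"
      using insert.prems[of s] s insert.hyps by simp
    then have "h q * F s = h q * h (b s) + h y * (h (a s x) * (h q * F x)
        + h q * (\<Sum>t\<in>S. h (a s t) * F t))"
      by (metis (no_types, lifting) distrib_left mult.left_commute)
    then have "h q * F s + h y * h (a x x) * F s = h (b' s) + h y * (\<Sum>t\<in>S. h (a' s t) * F t)"
      unfolding A Fx by (simp add: b'_def h_add h_mult algebra_simps)
    then show ?thesis by (simp add: q_def h_diff h_mult h_1 algebra_simps)
  qed
  from insert.IH[OF this] obtain r p where
    rp: "\<And>s. s \<in> S \<Longrightarrow> h (1 + y * r) * F s = h (p s)" by metis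
  \<comment> \<open>The product of both denominators, expanded to exhibit the new witness for
    \<open>r\<close>.\<close>
  have qr: "1 + y * (r - a x x - y * a x x * r) = q * (1 + y * r)"
    by (simp add: q_def algebra_simps)
  \<comment> \<open>Back substitution: multiply \<open>Fx\<close> by the old denominator, which
    turns each \<open>F t\<close> on the right into the polynomial \<open>p t\<close>.\<close>
  have "h (q * (1 + y * r)) * F x = h ((1 + y * r) * b x + y * (\<Sum>t\<in>S. a x t * p t))"
  proof -
    have "h (q * (1 + y * r)) * F x = h (1 + y * r) * (h q * F x)" by (simp add: h_mult ac_simps)
    also have "\<dots> = h ((1 + y * r) * b x) + h y * (\<Sum>t\<in>S. h (a x t) * (h (1 + y * r) * F t))"
      unfolding Fx by (simp only: h_mult[of "1 + y * r"] distrib_left sum_distrib_left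
          mult.left_commute[of "h (1 + y * r)"])
    also have "\<dots> = h ((1 + y * r) * b x + y * (\<Sum>t\<in>S. a x t * p t))"
    proof -
      have "(\<Sum>t\<in>S. h (a x t) * (h (1 + y * r) * F t)) = h (\<Sum>t\<in>S. a x t * p t)"
        using insert.hyps(1) by (auto intro!: sum.cong simp: rp h_sum h_mult)
      then show ?thesis by (simp only: h_add[of "_ * b x"] h_mult[of y])
    qed
    finally show ?thesis .
  qed
  moreover have "h (q * (1 + y * r)) * F s = h (q * p s)" if "s \<in> S" for s
    using rp[OF that] by (simp add: h_mult mult.assoc)
  ultimately show ?case unfolding qr[symmetric] by blast
qed

section \<open>Embedding of polynomials in power series\<close>

lemma fps2_of_poly2_nth: "fps_nth (fps2_of_poly2 P) n = fps_of_poly (coeff P n)"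
  by (simp add: fps2_of_poly2_def coeff_map_poly)

lemma fps2_of_poly2_add: "fps2_of_poly2 (P + Q) = fps2_of_poly2 P + fps2_of_poly2 Q"
  by (rule fps_ext) (simp add: fps2_of_poly2_nth fps_of_poly_add)

lemma fps2_of_poly2_mult: "fps2_of_poly2 (P * Q) = fps2_of_poly2 P * fps2_of_poly2 Q"
  by (rule fps_ext)
    (simp add: fps2_of_poly2_nth fps_mult_nth coeff_mult fps_of_poly_sum fps_of_poly_mult
      atLeast0AtMost)

lemma fps2_of_poly2_0: "fps2_of_poly2 0 = 0"
  by (simp add: fps2_of_poly2_def)

lemma fps2_of_poly2_1: "fps2_of_poly2 1 = 1"
  by (rule fps_ext) (simp add: fps2_of_poly2_nth)

lemma fps2_of_poly2_Y: "fps2_of_poly2 (monom 1 1) = fps_X"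
  by (rule fps_ext) (simp add: fps2_of_poly2_nth fps_X_def)

lemma fps2_of_poly2_X: "fps2_of_poly2 [:[:0, 1:]:] = fps_const fps_X"
  by (rule fps_ext) (auto simp: fps2_of_poly2_nth coeff_pCons fps_of_poly_pCons split: nat.splits)

text \<open>A single descendant thus becomes a row of the linear system indexed by all of
  \<open>S\<close>.\<close>

lemma sum_fps2_of_poly2_of_bool:
  assumes "finite S" "u \<in> S"
  shows "(\<Sum>t\<in>S. fps2_of_poly2 (p * of_bool (t = u)) * F t) = fps2_of_poly2 p * F u"
proof -
  have "(\<Sum>t\<in>S. fps2_of_poly2 (p * of_bool (t = u)) * F t)
      = (\<Sum>t\<in>S. if t = u then fps2_of_poly2 p * F t else 0)"
    by (rule sum.cong) (auto simp: fps2_of_poly2_0)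
  then show ?thesis using assms by simp
qed

section \<open>Tree automorphisms and their descendants\<close>

lemma W_bij: "w \<in> W \<Longrightarrow> bij w"
  and W_Nil: "w \<in> W \<Longrightarrow> w [] = []"
  and W_adj: "w \<in> W \<Longrightarrow> tree_adj (w s) (w t) \<longleftrightarrow> tree_adj s t"
  by (auto simp: W_def)

text \<open>Automorphisms fixing the root preserve parenthood: going away from the root, a child is
  sent to a neighbour of its parent's image, and injectivity rules out the grandparent's
  image.\<close>

lemma W_Cons:
  assumes w: "w \<in> W"
  shows "\<exists>y. w (x # t) = y # w t"
proof (induction t arbitrary: x)
  case Nil
  have "tree_adj (w []) (w [x])" using W_adj[OF w] by (simp add: tree_adj_def)
  then show ?case by (simp add: tree_adj_def W_Nil[OF w])
next
  case (Cons z s)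
  obtain y where y: "w (z # s) = y # w s" using Cons.IH by blast
  have "tree_adj (w (z # s)) (w (x # z # s))" using W_adj[OF w] by (simp add: tree_adj_def)
  moreover have "w s \<noteq> w (x # z # s)"
  proof
    assume "w s = w (x # z # s)"
    then have "s = x # z # s" using W_bij[OF w] by (simp add: bij_def inj_eq)
    then have "length s = length (x # z # s)" by (rule arg_cong)
    then show False by simp
  qed
  ultimately show ?case using y by (auto simp: tree_adj_def)
qed

lemma W_length:
  assumes "w \<in> W"
  shows "length (w t) = length t"
proof (induction t)
  case Nil
  then show ?case by (simp add: W_Nil[OF assms])
next
  case (Cons x t)
  then show ?case using W_Cons[OF assms, of x t] by auto
qed

text \<open>Children arise by prepending, so the last letter tells which of the two subtrees below
  the root contains a word, and that subtree is moved as a whole.\<close>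

lemma W_last:
  assumes w: "w \<in> W"
  shows "last (w (t @ [x])) = last (w [x])"
proof (induction t)
  case (Cons z t)
  have "w (t @ [x]) \<noteq> []" using W_length[OF w, of "t @ [x]"] by auto
  then show ?case using Cons W_Cons[OF w, of z "t @ [x]"] by auto
qed simp

lemma W_comp: "u \<in> W \<Longrightarrow> v \<in> W \<Longrightarrow> u \<circ> v \<in> W"
  by (auto simp: W_def intro: bij_comp)

lemma sigma_sigma: "sigma (sigma t) = t"
  by (simp add: sigma_def)

lemma tree_adj_snoc: "tree_adj (s @ [x]) (t @ [x]) \<longleftrightarrow> tree_adj s t"
  by (simp add: tree_adj_def flip: append_Cons)

lemma sigma_Cons: "\<exists>y. sigma (x # t) = y # sigma t"
  by (cases "t = []") (auto simp: sigma_def)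

lemma tree_adj_sigma: "tree_adj s t \<Longrightarrow> tree_adj (sigma s) (sigma t)"
  unfolding tree_adj_def using sigma_Cons by blast

lemma sigma_in_W: "sigma \<in> W"
proof -
  have "bij sigma" by (rule o_bij[of sigma]) (auto simp: sigma_sigma)
  moreover have "tree_adj (sigma s) (sigma t) \<longleftrightarrow> tree_adj s t" for s t
    using tree_adj_sigma[of s t] tree_adj_sigma[of "sigma s" "sigma t"] by (auto simp: sigma_sigma)
  ultimately show ?thesis by (simp add: W_def sigma_def)
qed

lemma section_in_W:
  assumes w: "w \<in> W" and "w [x] = [x]" and "w [\<not> x] = [\<not> x]"
  shows "(\<lambda>t. butlast (w (t @ [x]))) \<in> W" (is "?u \<in> W")
    and "w (t @ [x]) = butlast (w (t @ [x])) @ [x]"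
proof -
  have u: "w (t @ [x]) = ?u t @ [x]" for t
  proof -
    have "w (t @ [x]) \<noteq> []" using W_length[OF w, of "t @ [x]"] by auto
    moreover have "last (w (t @ [x])) = x" using W_last[OF w, of t x] assms(2) by simp
    ultimately show ?thesis using append_butlast_last_id[of "w (t @ [x])"] by simp
  qed
  then show "w (t @ [x]) = butlast (w (t @ [x])) @ [x]" by blast
  have "inj ?u"
  proof (rule injI)
    fix s t assume "?u s = ?u t"
    then have "w (s @ [x]) = w (t @ [x])" using u by metis
    then show "s = t" using W_bij[OF w] by (simp add: bij_def inj_eq)
  qed
  moreover have "\<exists>t. s = ?u t" for s
  proof -
    obtain r where r: "w r = s @ [x]" using W_bij[OF w] by (metis bij_pointE)
    have "r \<noteq> []" using r W_Nil[OF w] by auto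
    then obtain t z where t: "r = t @ [z]" by (metis rev_exhaust)
    have "last (w [z]) = x" using W_last[OF w, of t z] r t by simp
    \<comment> \<open>Surjectivity rests on this: fixing \<open>[\<not> x]\<close> prevents a word
      of the other subtree from being sent to \<open>s @ [x]\<close>.\<close>
    then have "z = x" using assms(3) by (cases "z = x") auto
    then show ?thesis using r t by (intro exI[of _ t]) simp
  qed
  ultimately have "bij ?u" unfolding bij_def surj_def by blast
  moreover have "?u [] = []" using assms(2) by simp
  moreover have "tree_adj (?u s) (?u t) \<longleftrightarrow> tree_adj s t" for s t
    using W_adj[OF w, of "s @ [x]" "t @ [x]"] u tree_adj_snoc by metis
  ultimately show "?u \<in> W" by (simp add: W_def)
qed

lemma pair_snoc: "pair u v (t @ [x]) = (if x then v t @ [True] else u t @ [False])"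
  by (simp add: pair_def)

lemma W_pairE:
  assumes w: "w \<in> W" and "w [False] = [False]"
  obtains u v where "u \<in> W" "v \<in> W" "w = pair u v"
proof -
  have "length (w [True]) = 1" using W_length[OF w] by simp
  moreover have "w [True] \<noteq> [False]"
    using W_bij[OF w] assms(2) by (metis bij_def inj_eq list.inject)
  ultimately have T: "w [True] = [True]" by (cases "w [True]") auto
  let ?u = "\<lambda>x t. butlast (w (t @ [x]))"
  have "w t = pair (?u False) (?u True) t" for t
  proof (cases t rule: rev_cases)
    case Nil
    then show ?thesis by (simp add: pair_def W_Nil[OF w])
  next
    case (snoc s x)
    then show ?thesis using section_in_W(2)[OF w, of x s] T assms(2)
      by (cases x) (auto simp: pair_snoc)
  qed
  then have "w = pair (?u False) (?u True)" by blast
  then show ?thesis using that section_in_W(1)[OF w] T assms(2) by force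
qed

text \<open>The two vertices of level 1 are fixed or swapped. If swapped, composing with the
  involution \<open>sigma\<close> reduces to the fixed case.\<close>

lemma W_cases:
  assumes w: "w \<in> W"
  obtains u v where "u \<in> W" "v \<in> W" "w = pair u v"
  | u v where "u \<in> W" "v \<in> W" "w = pair u v \<circ> sigma"
proof (cases "w [False] = [False]")
  case True
  then show ?thesis using W_pairE[OF w] that(1) by metis
next
  case False
  have "w \<circ> sigma \<in> W" using W_comp[OF w sigma_in_W] .
  moreover have "(w \<circ> sigma) [False] = [False]"
  proof -
    have "w [True] \<noteq> w [False]" using W_bij[OF w] by (metis bij_def inj_eq list.inject)
    moreover have "length (w [True]) = 1" "length (w [False]) = 1" using W_length[OF w] by simp_all
    ultimately have "w [True] = [False]" using False
      by (cases "w [True]"; cases "w [False]") auto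
    then show ?thesis by (simp add: sigma_def)
  qed
  ultimately obtain u v where "u \<in> W" "v \<in> W" "w \<circ> sigma = pair u v" using W_pairE by metis
  moreover have "w \<circ> sigma \<circ> sigma = w" by (auto simp: sigma_sigma)
  ultimately show ?thesis using that(2) by metis
qed

section \<open>Closure properties of descendants\<close>

lemma first_descendants_subset_W: "first_descendants w \<subseteq> W"
  by (auto simp: first_descendants_def W_comp)

lemma descendants_subset_W: "w \<in> W \<Longrightarrow> descendants n w \<subseteq> W"
  by (cases n) (use first_descendants_subset_W in auto)

text \<open>This makes \<open>insert w (Desc w)\<close> closed under first descendants, hence a
  suitable index set for a closed linear system.\<close>

lemma first_descendants_subset_Desc:
  assumes "x \<in> insert w (Desc w)"
  shows "first_descendants x \<subseteq> Desc w"
proof -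
  obtain n where "x \<in> descendants n w"
    using assms by (metis Desc_def UN_E descendants.simps(1) insert_iff)
  then have "first_descendants x \<subseteq> descendants (Suc n) w" by auto
  then show ?thesis by (force simp: Desc_def)
qed

section \<open>Orbit counts\<close>

lemma finite_level: "finite (level n)"
  unfolding level_def using finite_lists_length_eq[of "UNIV :: bool set" n] by simp

lemma card_level: "card (level n) = 2 ^ n"
  unfolding level_def using card_lists_length_eq[of "UNIV :: bool set" n] by simp

lemma level_Suc: "level (Suc n) = (\<lambda>t. t @ [False]) ` level n \<union> (\<lambda>t. t @ [True]) ` level n"
proof -
  have "t \<in> (\<lambda>t. t @ [False]) ` level n \<union> (\<lambda>t. t @ [True]) ` level n" if "t \<in> level (Suc n)" for t
    using that by (cases t rule: rev_cases) (auto simp: level_def)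
  then show ?thesis by (auto simp: level_def)
qed

lemma orbit_subset_level:
  assumes "w \<in> W" "t \<in> level n"
  shows "orbit w t \<subseteq> level n"
proof
  fix s assume "s \<in> orbit w t"
  then show "s \<in> level n"
    by induction (use assms in \<open>simp_all add: level_def W_length\<close>)
qed

text \<open>The starting point is the iterate with exponent 0, which \<open>orbit\<close> does not
  list. By the pigeonhole principle two positive iterates agree, and injectivity cancels the smaller
  exponent.\<close>

lemma self_in_orbit_if_finite:
  assumes "inj f" "finite (orbit f x)"
  shows "x \<in> orbit f x"
proof -
  have "range (\<lambda>n. (f ^^ Suc n) x) \<subseteq> orbit f x"
    unfolding orbit_altdef by blast
  then have "\<not> inj (\<lambda>n. (f ^^ Suc n) x)"
    using assms(2) by (metis finite_subset finite_imageD infinite_UNIV_nat)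
  then obtain i j where ij: "i < j" "(f ^^ Suc i) x = (f ^^ Suc j) x"
    unfolding inj_def by (metis linorder_neqE_nat)
  have "Suc j = Suc i + (j - i)" using ij(1) by simp
  then have "(f ^^ Suc j) x = (f ^^ Suc i) ((f ^^ (j - i)) x)"
    by (simp only: funpow_add comp_apply)
  with ij(2) have "(f ^^ Suc i) x = (f ^^ Suc i) ((f ^^ (j - i)) x)" by (rule trans)
  moreover have "inj (f ^^ Suc i)" using assms(1) by (rule inj_fn)
  ultimately have "x = (f ^^ (j - i)) x" by (simp only: inj_eq)
  then show ?thesis using ij(1) unfolding orbit_altdef
    by (metis (mono_tags, lifting) mem_Collect_eq zero_less_diff)
qed

lemma W_self_in_orbit:
  assumes "w \<in> W"
  shows "t \<in> orbit w t"
proof (rule self_in_orbit_if_finite)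
  show "inj w" using W_bij[OF assms] by (rule bij_is_inj)
  show "finite (orbit w t)"
    using orbit_subset_level[OF assms, of t "length t"] finite_level finite_subset
    by (auto simp: level_def)
qed

lemma orbit_semiconj:
  assumes "\<And>t. f (e t) = e (g t)"
  shows "orbit f (e t) = e ` orbit g t"
proof
  show "orbit f (e t) \<subseteq> e ` orbit g t"
  proof
    fix s assume "s \<in> orbit f (e t)"
    then show "s \<in> e ` orbit g t"
      by induction (auto simp: assms intro: orbit.intros)
  qed
  have "e s \<in> orbit f (e t)" if "s \<in> orbit g t" for s
    using that by induction (auto simp flip: assms intro: orbit.intros)
  then show "e ` orbit g t \<subseteq> orbit f (e t)" by blast
qed

text \<open>An orbit cannot exceed its level in size. Hence the cut-off \<open>m \<le> n\<close> in
  \<open>Phi\<close> alters no coefficient.\<close>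

lemma orbit_count_gt_level:
  assumes "w \<in> W" "n < m"
  shows "orbit_count m n w = 0"
proof -
  have "card A \<noteq> 2 ^ m" if "A \<in> orbit w ` level n" for A
  proof -
    have "A \<subseteq> level n" using that orbit_subset_level[OF assms(1)] by blast
    then have "card A \<le> 2 ^ n" using card_mono[OF finite_level] card_level by metis
    also have "\<dots> < 2 ^ m" using assms(2) by simp
    finally show ?thesis by simp
  qed
  then have "{A \<in> orbit w ` level n. card A = 2 ^ m} = {}" by blast
  then show ?thesis by (simp only: orbit_count_def card.empty)
qed

lemma orbit_count_level_0:
  assumes "w \<in> W"
  shows "orbit_count m 0 w = (if m = 0 then 1 else 0)"
proof -
  have l: "level 0 = {[]}" by (auto simp: level_def)
  have "orbit w ` level 0 = {{[]}}"
    using orbit_subset_level[OF assms, of "[]" 0] orbit_nonempty[of w "[]"]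
    by (simp add: l subset_singleton_iff)
  then have "{A \<in> orbit w ` level 0. card A = 2 ^ m} = (if m = 0 then {{[]}} else {})"
    by (cases m) auto
  then show ?thesis by (simp add: orbit_count_def)
qed

lemma orbit_count_pair:
  assumes "u \<in> W" "v \<in> W"
  shows "orbit_count m (Suc n) (pair u v) = orbit_count m n u + orbit_count m n v"
proof -
  define e where "e x t = t @ [x]" for x :: bool and t
  have inj: "inj (e x)" for x by (simp add: e_def inj_def)
  define C where "C u = {A \<in> orbit u ` level n. card A = 2 ^ m}" for u
  have card: "card (e x ` A) = card A" for x A
    using inj by (metis card_image inj_on_subset subset_UNIV)
  have orb: "orbit (pair u v) (e False t) = e False ` orbit u t"
    "orbit (pair u v) (e True t) = e True ` orbit v t" for t
    by (rule orbit_semiconj; simp add: e_def pair_snoc)+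
  have lev: "level (Suc n) = e False ` level n \<union> e True ` level n"
    using level_Suc[of n] by (simp add: e_def)
  have "{A \<in> orbit (pair u v) ` level (Suc n). card A = 2 ^ m}
      = image (e False) ` C u \<union> image (e True) ` C v"
    by (force simp: lev C_def orb card image_Un image_image)
  \<comment> \<open>The two families share no orbit: orbits are nonempty, and their words end in
    different letters.\<close>
  moreover have "image (e False) ` C u \<inter> image (e True) ` C v = {}"
  proof -
    have "e False ` A \<noteq> e True ` B" if "A \<in> C u" for A B
    proof -
      have "A \<noteq> {}" using that orbit_nonempty by (auto simp: C_def)
      then show ?thesis by (auto simp: e_def)
    qed
    then show ?thesis by blast
  qed
  moreover have "finite (C u)" for u by (simp add: C_def finite_level)
  moreover have "card (image (e x) ` C u) = card (C u)" for x u
    by (rule card_image) (use inj inj_on_image[of "e x"] in \<open>auto simp: inj_on_def inj_def\<close>)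
  ultimately show ?thesis
    by (simp add: orbit_count_def C_def card_Un_disjoint)
qed

text \<open>The map alternates between the two subtrees, and its square acts on the words ending in
  \<open>False\<close> as \<open>u \<circ> v\<close>.\<close>

lemma orbit_pair_sigma:
  assumes "u \<in> W" "v \<in> W"
  shows "orbit (pair u v \<circ> sigma) (t @ [False])
    = (\<lambda>t. t @ [False]) ` orbit (u \<circ> v) t \<union> (\<lambda>t. v t @ [True]) ` orbit (u \<circ> v) t"
    (is "?O = ?R")
proof
  let ?w = "pair u v \<circ> sigma"
  have F: "?w (s @ [False]) = v s @ [True]" and T: "?w (s @ [True]) = u s @ [False]" for s
    by (simp_all add: sigma_def pair_snoc)
  have t: "t \<in> orbit (u \<circ> v) t" using assms by (intro W_self_in_orbit W_comp)
  show "?O \<subseteq> ?R"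
  proof
    fix s assume "s \<in> ?O"
    then show "s \<in> ?R"
    proof induction
      case base
      \<comment> \<open>The first iterate is \<open>v t @ [True]\<close>, which requires
        \<open>t\<close> to lie in its own orbit under \<open>u \<circ> v\<close>.\<close>
      show ?case unfolding F using t by blast
    next
      case (step s)
      from step(2) show ?case
      proof
        assume "s \<in> (\<lambda>t. t @ [False]) ` orbit (u \<circ> v) t"
        then obtain r where r: "r \<in> orbit (u \<circ> v) t" "s = r @ [False]" by blast
        then have "?w s = v r @ [True]" using F by simp
        then show ?thesis using r(1) by blast
      next
        assume "s \<in> (\<lambda>t. v t @ [True]) ` orbit (u \<circ> v) t"
        then obtain r where r: "r \<in> orbit (u \<circ> v) t" "s = v r @ [True]" by blast
        then have "?w s = (u \<circ> v) r @ [False]" using T by simp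
        then show ?thesis using orbit.step[OF r(1)] by blast
      qed
    qed
  qed
  have "s @ [False] \<in> ?O" if "s \<in> orbit (u \<circ> v) t" for s
    using that
  proof induction
    case base
    have "?w (?w (t @ [False])) \<in> ?O" by (intro orbit.intros)
    then show ?case by (simp only: F T comp_apply[of u v])
  next
    case (step s)
    then have "?w (?w (s @ [False])) \<in> ?O" by (intro orbit.step)
    then show ?case by (simp only: F T comp_apply[of u v])
  qed
  moreover from this have "v s @ [True] \<in> ?O" if "s \<in> orbit (u \<circ> v) t" for s
    using orbit.step[of "s @ [False]" ?w "t @ [False]"] that by (simp only: F)
  ultimately show "?R \<subseteq> ?O" by blast
qed

lemma orbit_count_pair_sigma:
  assumes u: "u \<in> W" and v: "v \<in> W" and "pair u v \<circ> sigma \<in> W"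
  shows "orbit_count m (Suc n) (pair u v \<circ> sigma)
    = (case m of 0 \<Rightarrow> 0 | Suc k \<Rightarrow> orbit_count k n (u \<circ> v))"
proof -
  let ?w = "pair u v \<circ> sigma"
  define E where "E A = (\<lambda>t. t @ [False]) ` A \<union> (\<lambda>t. v t @ [True]) ` A" for A
  have lower: "orbit ?w (t @ [False]) = E (orbit (u \<circ> v) t)" for t
    using orbit_pair_sigma[OF u v] by (simp add: E_def)
  \<comment> \<open>One application of \<open>?w\<close> moves a word ending in \<open>True\<close>
    into the other subtree without changing its orbit, so every orbit on the level has the form
    \<open>E A\<close>.\<close>
  have "orbit ?w (t @ [True]) = orbit ?w (?w (t @ [True]))" for t
    using self_in_orbit_step[OF W_self_in_orbit[OF assms(3)]] by metis
  then have upper: "orbit ?w (t @ [True]) = E (orbit (u \<circ> v) (u t))" for t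
    using lower[of "u t"] by (simp add: sigma_def pair_snoc)
  have "orbit ?w ` level (Suc n) = E ` orbit (u \<circ> v) ` level n"
  proof -
    have "u t \<in> level n" if "t \<in> level n" for t
      using that W_length[OF u] by (simp add: level_def)
    then show ?thesis unfolding level_Suc image_Un image_image lower upper by blast
  qed
  moreover have card_E: "card (E A) = 2 * card A" if "A \<in> orbit (u \<circ> v) ` level n" for A
  proof -
    have "A \<subseteq> level n" using that orbit_subset_level[OF W_comp[OF u v]] by blast
    then have "finite A" using finite_level finite_subset by blast
    moreover have "inj v" using W_bij[OF v] by (rule bij_is_inj)
    then have "inj (\<lambda>t. v t @ [True])" by (simp add: inj_def)
    then have "card ((\<lambda>t. v t @ [True]) ` A) = card A"
      by (metis card_image inj_on_subset subset_UNIV)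
    moreover have "card ((\<lambda>t. t @ [False]) ` A) = card A"
      by (rule card_image) (simp add: inj_on_def)
    ultimately show ?thesis unfolding E_def by (subst card_Un_disjoint) auto
  qed
  ultimately have "{A \<in> orbit ?w ` level (Suc n). card A = 2 ^ m}
      = E ` {A \<in> orbit (u \<circ> v) ` level n. 2 * card A = 2 ^ m}" by auto
  \<comment> \<open>\<open>A\<close> can be read off from \<open>E A\<close> as its part in the
    subtree at \<open>[False]\<close>.\<close>
  moreover have "inj E"
  proof (rule injI)
    fix A B assume "E A = E B"
    moreover have "A = {t. t @ [False] \<in> E A}" for A by (auto simp: E_def)
    ultimately show "A = B" by metis
  qed
  then have "card (E ` \<A>) = card \<A>" for \<A>
    by (metis card_image inj_on_subset subset_UNIV)
  ultimately have "orbit_count m (Suc n) ?w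
      = card {A \<in> orbit (u \<circ> v) ` level n. 2 * card A = 2 ^ m}"
    by (simp only: orbit_count_def)
  \<comment> \<open>For \<open>m = 0\<close> this excludes orbits of length 1; for
    \<open>m = Suc k\<close> the factor 2 cancels.\<close>
  moreover have "2 * k \<noteq> 1" for k :: nat by presburger
  ultimately show ?thesis by (cases m) (auto simp: orbit_count_def)
qed

section \<open>Functional equations for \<open>Phi\<close>\<close>

lemma Phi_nth: "w \<in> W \<Longrightarrow> fps_nth (fps_nth (Phi w) n) m = int (orbit_count m n w)"
  by (simp add: Phi_def orbit_count_gt_level)

text \<open>The summand 1 counts the root, and the outer \<open>fps_X\<close> shifts the level by
  one.\<close>

lemma Phi_pair:
  assumes "u \<in> W" "v \<in> W" "pair u v \<in> W"
  shows "Phi (pair u v) = 1 + fps_X * (Phi u + Phi v)"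
proof (intro fps_ext)
  fix n m
  show "fps_nth (fps_nth (Phi (pair u v)) n) m
    = fps_nth (fps_nth (1 + fps_X * (Phi u + Phi v)) n) m"
    using assms by (cases n) (simp_all add: Phi_nth orbit_count_level_0 orbit_count_pair)
qed

text \<open>Beyond the level shift, the inner variable \<open>fps_const fps_X\<close> records the
  doubling of every orbit length.\<close>

lemma Phi_pair_sigma:
  assumes "u \<in> W" "v \<in> W" "pair u v \<circ> sigma \<in> W"
  shows "Phi (pair u v \<circ> sigma) = 1 + fps_X * (fps_const fps_X * Phi (u \<circ> v))"
proof (intro fps_ext)
  fix n m
  show "fps_nth (fps_nth (Phi (pair u v \<circ> sigma)) n) m
    = fps_nth (fps_nth (1 + fps_X * (fps_const fps_X * Phi (u \<circ> v))) n) m"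
    using assms W_comp[OF assms(1,2)]
    by (cases n; cases m) (simp_all add: Phi_nth orbit_count_level_0 orbit_count_pair_sigma)
qed

lemma Phi_linear_equation:
  assumes "w \<in> W" "finite S" "first_descendants w \<subseteq> S"
  shows "\<exists>a. Phi w = 1 + fps_X * (\<Sum>t\<in>S. fps2_of_poly2 (a t) * Phi t)"
  using assms(1)
proof (cases rule: W_cases)
  case (1 u v)
  have "u \<in> S" "v \<in> S" using 1 assms(3) by (auto simp: first_descendants_def)
  \<comment> \<open>Adding indicators also covers \<open>u = v\<close>, where the coefficient is
    2.\<close>
  then have sum: "Phi u + Phi v = (\<Sum>t\<in>S. fps2_of_poly2 (of_bool (t = u) + of_bool (t = v)) * Phi t)"
    using assms(2) by (simp only: fps2_of_poly2_add distrib_right sum.distrib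
      sum_fps2_of_poly2_of_bool[where p = 1, unfolded mult_1_left fps2_of_poly2_1])
  have "Phi w = 1 + fps_X * (Phi u + Phi v)" using Phi_pair 1 assms(1) by blast
  then show ?thesis unfolding sum
    by (rule exI[of _ "\<lambda>t. of_bool (t = u) + of_bool (t = v)"])
next
  case (2 u v)
  have "u \<circ> v \<in> S" using 2 assms(3) by (auto simp: first_descendants_def)
  then have sum: "fps_const fps_X * Phi (u \<circ> v)
      = (\<Sum>t\<in>S. fps2_of_poly2 ([:[:0, 1:]:] * of_bool (t = u \<circ> v)) * Phi t)"
    using assms(2) by (simp only: sum_fps2_of_poly2_of_bool fps2_of_poly2_X)
  have "Phi w = 1 + fps_X * (fps_const fps_X * Phi (u \<circ> v))"
    using Phi_pair_sigma 2 assms(1) by blast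
  then show ?thesis unfolding sum
    by (rule exI[of _ "\<lambda>t. [:[:0, 1:]:] * of_bool (t = u \<circ> v)"])
qed

theorem theorem2p7:
  fixes w :: "word \<Rightarrow> word"
  assumes "w \<in> W" and "Phi_finite w"
  shows "\<exists>P Q R :: int poly poly. Q = 1 + monom 1 1 * R \<and> expansion_of_quotient (Phi w) P Q"
proof -
  \<comment> \<open>\<open>Desc w\<close> starts with the first descendants and may miss
    \<open>w\<close>, whose series must be among the unknowns.\<close>
  define S where "S = insert w (Desc w)"
  have S: "finite S" using assms(2) by (simp add: S_def Phi_finite_def)
  have "S \<subseteq> W" using assms(1) descendants_subset_W by (auto simp: S_def Desc_def)
  moreover have "first_descendants s \<subseteq> S" if "s \<in> S" for s
    using first_descendants_subset_Desc[of s w] that by (auto simp: S_def)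
  ultimately have "\<exists>a. Phi s = 1 + fps_X * (\<Sum>t\<in>S. fps2_of_poly2 (a t) * Phi t)"
    if "s \<in> S" for s using Phi_linear_equation[OF _ S, of s] that by blast
  then obtain a where "\<And>s. s \<in> S \<Longrightarrow>
      Phi s = 1 + fps_X * (\<Sum>t\<in>S. fps2_of_poly2 (a s t) * Phi t)" by metis
  \<comment> \<open>Elimination with \<open>y\<close> taken as the polynomial \<open>Y\<close> makes
    the common denominator 1 plus a multiple of \<open>Y\<close>; its instance at \<open>w\<close>
    is the claim.\<close>
  then have "\<exists>r. \<forall>s\<in>S. \<exists>p. fps2_of_poly2 (1 + monom 1 1 * r) * Phi s = fps2_of_poly2 p"
    by (intro linear_system_common_denominator[where b = "\<lambda>_. 1" and a = a] S
        fps2_of_poly2_add fps2_of_poly2_mult fps2_of_poly2_1)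
      (simp only: fps2_of_poly2_1 fps2_of_poly2_Y)
  then show ?thesis by (auto simp: S_def expansion_of_quotient_def mult.commute)
qed

end
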